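(* Let $g\colon\mathbb{R}^n\to\mathbb{R}\cup\{\infty\}$ and $h\colon\mathbb{R}^n\to\mathbb{R}\cup\{\infty\}$ be polyhedral convex functions. Then the following statements are equivalent: (a) The problem $\min_{x\in\operatorname{dom} g}[g(x)-h(x)]$ has an optimal solution. (b) The problem $\min_{y\in\operatorname{dom} h^*}[h^*(y)-g^*(y)]$ has an optimal solution. (c) $\operatorname{dom} g\neq\emptyset$, $\operatorname{dom} g\subseteq\operatorname{dom} h$, and $0^+\operatorname{epi} g\subseteq 0^+\operatorname{epi} h$. (d) $\operatorname{dom} h^*\neq\emptyset$, $\operatorname{dom} h^*\subseteq\operatorname{dom} g^*$, and $0^+\operatorname{epi} h^*\subseteq 0^+\operatorname{epi} g^*$.
   Context: For a function $f$ on $\mathbb{R}^n$, $\operatorname{dom} f=\{x\in\mathbb{R}^n\mid f(x)<\infty\}$ and $\operatorname{epi} f=\{(x,r)\in\mathbb{R}^n\times\mathbb{R}\mid r\ge f(x)\}$. A convex function is called polyhedral if its epigraph is a convex polyhedron (a finite intersection of closed half-spaces). The conjugate of $f$ is $f^*(y)=\sup_{x\in\mathbb{R}^n}[y^Tx-f(x)]$. The recession cone of a convex set $C\subseteq\mathbb{R}^k$ is $0^+C=\{y\in\mathbb{R}^k\mid C+\{y\}\subseteq C\}$. For a problem $\min_{x\in\operatorname{dom} p}[p(x)-q(x)]$ with convex functions $p,q$, the value $p(x)-q(x)$ is $-\infty$ if $x\in\operatorname{dom} p\setminus\operatorname{dom} q$; an optimal solution is a point $x^0\in\operatorname{dom}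 p\cap\operatorname{dom} q$ (so that the value is finite) with $p(x^0)-q(x^0)\le p(x)-q(x)$ for all $x\in\operatorname{dom} p$.
   Formalization: The formal statement additionally assumes that g is not identically +∞; for g ≡ +∞ the stated equivalence is false, since (a) and (c) fail (dom g is empty) while (d) holds (g* ≡ −∞). *)

theory Defs
  imports "HOL-Analysis.Analysis"
begin

definition eff_dom :: "('a \<Rightarrow> ereal) \<Rightarrow> 'a set" where
  "eff_dom f = {x. f x < \<infinity>}"

text \<open>The library's \<open>epigraph\<close> is for real-valued functions; here the values are extended real,
  while the epigraph still lives in the real space \<open>'a \<times> real\<close>.\<close>

definition epi :: "('a \<Rightarrow> ereal) \<Rightarrow> ('a \<times> real) set" where
  "epi f = {(x, r). f x \<le> ereal r}"

text \<open>Extended-real-valued convexity is convexity of the epigraph. The constantly \<open>\<infinity>\<close> function,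
  whose epigraph is empty, satisfies this definition.\<close>

definition polyhedral_convex :: "('a::euclidean_space \<Rightarrow> ereal) \<Rightarrow> bool" where
  "polyhedral_convex f \<longleftrightarrow> convex (epi f) \<and> polyhedron (epi f)"

definition conjugate :: "('a::real_inner \<Rightarrow> ereal) \<Rightarrow> 'a \<Rightarrow> ereal" where
  "conjugate f y = (SUP x. ereal (y \<bullet> x) - f x)"

definition recession_cone :: "'a::real_vector set \<Rightarrow> 'a set" where
  "recession_cone C = {y. (\<lambda>x. x + y) ` C \<subseteq> C}"

text \<open>Optimality for minimising \<open>p - q\<close> over \<open>eff_dom p\<close>. Extended-real subtraction gives the value
  \<open>-\<infinity>\<close> at points of \<open>eff_dom p - eff_dom q\<close>. The finiteness condition is automatic unless \<open>p\<close> or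
  \<open>q\<close> takes the value \<open>-\<infinity>\<close>, as the conjugate of the constantly \<open>\<infinity>\<close> function does.\<close>

definition dc_optimal_solution :: "('a \<Rightarrow> ereal) \<Rightarrow> ('a \<Rightarrow> ereal) \<Rightarrow> 'a \<Rightarrow> bool" where
  "dc_optimal_solution p q x0 \<longleftrightarrow>
     x0 \<in> eff_dom p \<inter> eff_dom q \<and> \<bar>p x0 - q x0\<bar> \<noteq> \<infinity> \<and>
     (\<forall>x \<in> eff_dom p. p x0 - q x0 \<le> p x - q x)"

end

(* The cycle (a) => (b) => (d) => (c) => (a).
   (a) => (b): if x0 is optimal with value v, then h <= g - v, hence g* <= h* - v, and equality holds
   at any subgradient of h at x0, which exists because h is polyhedral.
   (b) => (d): g* <= h* - v carries a ray in epi h* to a ray in epi g*, and epi g* is closed convex.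
   (d) => (c): h is a maximum of finitely many affine functions on a polyhedron. The gradients of the
   affine functions lie in dom h*, the constraints of the polyhedron are recession directions of
   epi h*; both can be transported to g*.
   (c) => (a): epi g is generated by a finite set V and its recession cone. Let m be the minimum of
   r - h(x) over (x, r) in V. The translate {(x, r). h x <= r - m} of epi h is convex, contains V and
   admits the recession cone of epi g, so it contains epi g; that is, g - h >= m. *)

theory Submission
  imports Defs
begin

section \<open>Recession cones and generators of polyhedra\<close>

lemma recession_cone_iff: "w \<in> recession_cone S \<longleftrightarrow> (\<forall>x\<in>S. x + w \<in> S)"
  by (auto simp: recession_cone_def)

lemma recession_cone_multiple:
  assumes "w \<in> recession_cone S" "x \<in> S"
  shows "x + real n *\<^sub>R w \<in> S"
  using assms by (induction n) (auto simp: recession_cone_iff scaleR_add_left algebra_simps)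

text \<open>A point \<open>z + w\<close> is the limit of points on the segments from \<open>z\<close> to far points of the ray.\<close>

lemma ray_imp_recession_cone:
  fixes S :: "'a::real_normed_vector set"
  assumes "convex S" "closed S" and ray: "\<And>n. x + real n *\<^sub>R w \<in> S"
  shows "w \<in> recession_cone S"
  unfolding recession_cone_iff
proof
  fix z assume z: "z \<in> S"
  define f where "f n = z + inverse (real (Suc n)) *\<^sub>R (x - z) + w" for n
  have "f n \<in> S" for n
  proof -
    have "f n = (1 - inverse (real (Suc n))) *\<^sub>R z
        + inverse (real (Suc n)) *\<^sub>R (x + real (Suc n) *\<^sub>R w)"
      by (simp add: f_def algebra_simps del: of_nat_Suc)
    moreover have "\<dots> \<in> S"
      using z ray[of "Suc n"] \<open>convex S\<close> by (intro convexD) (auto simp: divide_simps simp del: of_nat_Suc)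
    ultimately show ?thesis by simp
  qed
  moreover have "f \<longlonglongrightarrow> z + 0 *\<^sub>R (x - z) + w"
    unfolding f_def by (intro tendsto_intros LIMSEQ_inverse_real_of_nat)
  ultimately show "z + w \<in> S"
    using closed_sequentially[OF \<open>closed S\<close>, of f] by simp
qed

text \<open>The \<open>V\<close>-representation of \<open>S\<close> (convex hull of \<open>V\<close> plus recession cone), phrased by its
  universal property so that it can be assembled facet by facet.\<close>

lemma polyhedron_generators:
  fixes S :: "'a::euclidean_space set"
  assumes "polyhedron S"
  shows "\<exists>V. finite V \<and> V \<subseteq> S \<and>
    (\<forall>Q. convex Q \<longrightarrow> V \<subseteq> Q \<longrightarrow> recession_cone S \<subseteq> recession_cone Q \<longrightarrow> S \<subseteq> Q)"
  using assms
\<comment> \<open>Induction on the dimension, shifted by one because \<open>aff_dim\<close> of the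
  empty set is -1.\<close>
proof (induction "nat (aff_dim S + 1)" arbitrary: S rule: less_induct)
  case less
  have convex: "convex S" and closed: "closed S"
    using less.prems by (simp_all add: polyhedron_imp_convex polyhedron_imp_closed)
  consider "S = {}" | v where "S = affine hull S" "v \<in> S" | "S \<noteq> {}" "S \<noteq> affine hull S"
    by blast
  then show ?case
  proof cases
    case 1
    then show ?thesis by auto
  next
    case 2
    have "affine S"
      by (subst 2(1)) (rule affine_affine_hull)
    \<comment> \<open>In an affine set all differences of points are recession directions, so one
      point generates.\<close>
    have "x - v \<in> recession_cone S" if "x \<in> S" for x
    proof -
      have "z + (x - v) \<in> S" if z: "z \<in> S" for z
      proof -
        have "z + 1 *\<^sub>R (x - v) \<in> S"
          using 2 z \<open>x \<in> S\<close> \<open>affine S\<close> by (intro mem_affine_3_minus)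
        then show ?thesis by simp
      qed
      then show ?thesis by (simp add: recession_cone_iff)
    qed
    then have "S \<subseteq> Q" if "v \<in> Q" "recession_cone S \<subseteq> recession_cone Q" for Q
      using that by (force simp: recession_cone_iff)
    with 2 show ?thesis by (intro exI[of _ "{v}"]) auto
  next
    case 3
    define \<F> where "\<F> = {F. F facet_of S}"
    have "\<exists>V. finite V \<and> V \<subseteq> F \<and>
      (\<forall>Q. convex Q \<longrightarrow> V \<subseteq> Q \<longrightarrow> recession_cone F \<subseteq> recession_cone Q \<longrightarrow> F \<subseteq> Q)"
      if "F \<in> \<F>" for F
    proof (rule less.hyps)
      show "polyhedron F"
        using that less.prems by (auto simp: \<F>_def facet_of_def intro: face_of_polyhedron_polyhedron)
      have "aff_dim F = aff_dim S - 1" "F \<noteq> {}"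
        using that by (auto simp: \<F>_def facet_of_def)
      then show "nat (aff_dim F + 1) < nat (aff_dim S + 1)"
        using aff_dim_geq[of F] aff_dim_negative_iff[of F] by linarith
    qed
    then obtain W where W: "\<And>F. F \<in> \<F> \<Longrightarrow> finite (W F) \<and> W F \<subseteq> F \<and>
      (\<forall>Q. convex Q \<longrightarrow> W F \<subseteq> Q \<longrightarrow> recession_cone F \<subseteq> recession_cone Q \<longrightarrow> F \<subseteq> Q)"
      by metis
    have subset: "F \<subseteq> S" if "F \<in> \<F>" for F
      using that by (simp add: \<F>_def facet_of_imp_subset)
    have rec: "recession_cone F \<subseteq> recession_cone S" if F: "F \<in> \<F>" for F
    proof
      fix w assume w: "w \<in> recession_cone F"
      obtain x where "x \<in> F" using F by (auto simp: \<F>_def facet_of_def)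
      then have "x + real n *\<^sub>R w \<in> S" for n
        using recession_cone_multiple[OF w] subset[OF F] by blast
      then show "w \<in> recession_cone S" by (rule ray_imp_recession_cone[OF convex closed])
    qed
    \<comment> \<open>A segment in the affine hull from \<open>S\<close> to its outside crosses a
      facet: if it missed the relative frontier, its part in \<open>S\<close> would be clopen in the
      segment, against connectedness.\<close>
    have boundary: "\<exists>t\<in>{0..1}. p + t *\<^sub>R (q - p) \<in> \<Union>\<F>"
      if p: "p \<in> S" and q: "q \<in> affine hull S" "q \<notin> S" for p q
    proof -
      have "closed_segment p q \<inter> rel_frontier S \<noteq> {}"
      proof
        assume "closed_segment p q \<inter> rel_frontier S = {}"
        then have eq: "closed_segment p q \<inter> S = closed_segment p q \<inter> rel_interior S"
          using closed rel_interior_subset[of S] by (auto simp: rel_frontier_def)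
        have "closed_segment p q \<subseteq> affine hull S"
          using p q by (intro closed_segment_subset) (auto simp: hull_inc affine_imp_convex)
        then have "openin (top_of_set (closed_segment p q)) (closed_segment p q \<inter> S)"
          unfolding eq 
          by (rule openin_subtopology_Int_subset[rotated])
            (simp add: openin_rel_interior inf.absorb2 rel_interior_subset[THEN order_trans] hull_subset)
        moreover have "closedin (top_of_set (closed_segment p q)) (closed_segment p q \<inter> S)"
          using closed by (rule closedin_closed_Int)
        ultimately have "closed_segment p q \<inter> S = {} \<or> closed_segment p q \<inter> S = closed_segment p q"
          using connected_segment[of p q] by (simp add: connected_clopen)
        with p q show False by auto
      qed
      then obtain y where y: "y \<in> closed_segment p q" "y \<in> rel_frontier S" by blast
      have "rel_frontier S = \<Union>\<F>"
        using rel_boundary_of_polyhedron[OF less.prems] closed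
        by (simp add: rel_frontier_def \<F>_def)
      with y obtain t where "t \<in> {0..1}" "y = (1 - t) *\<^sub>R p + t *\<^sub>R q" "y \<in> \<Union>\<F>"
        by (auto simp: in_segment)
      moreover from this have "y = p + t *\<^sub>R (q - p)" by (simp add: algebra_simps)
      ultimately show ?thesis by (intro bexI[of _ t]) simp_all
    qed
    show ?thesis
    proof (intro exI conjI allI impI)
      show "finite (\<Union>F\<in>\<F>. W F)"
        using W finite_polyhedron_facets[OF less.prems] by (auto simp: \<F>_def)
      show "(\<Union>F\<in>\<F>. W F) \<subseteq> S"
        using W subset by blast
      fix Q assume Q: "convex Q" "(\<Union>F\<in>\<F>. W F) \<subseteq> Q" "recession_cone S \<subseteq> recession_cone Q"
      have facets: "\<Union>\<F> \<subseteq> Q"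
      proof
        fix y assume "y \<in> \<Union>\<F>"
        then obtain F where F: "F \<in> \<F>" "y \<in> F" by blast
        have "W F \<subseteq> Q" "recession_cone F \<subseteq> recession_cone Q"
          using Q F rec by blast+
        then show "y \<in> Q" using W[OF F(1)] F(2) Q(1) by blast
      qed
      show "S \<subseteq> Q"
      proof
        fix p assume p: "p \<in> S"
        \<comment> \<open>The line through \<open>p\<close> and \<open>q\<close> reaches a facet,
          hence \<open>Q\<close>, on the side of \<open>q\<close>. On the other side, either the ray
          stays in \<open>S\<close> and is a recession direction leading back to \<open>p\<close>,
          or it also reaches a facet and \<open>p\<close> lies between two points of
          \<open>Q\<close>.\<close>
        obtain q where q: "q \<in> affine hull S" "q \<notin> S"
          using 3 hull_subset[of S affine] by blast
        obtain t where t: "t \<in> {0..1}" and tQ: "p + t *\<^sub>R (q - p) \<in> Q"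
          using boundary[OF p q] facets by blast
        show "p \<in> Q"
        proof (cases "\<forall>n. p + real n *\<^sub>R (t *\<^sub>R (p - q)) \<in> S")
          case True
          then have "t *\<^sub>R (p - q) \<in> recession_cone Q"
            using ray_imp_recession_cone[OF convex closed] Q(3) by blast
          with tQ have "p + t *\<^sub>R (q - p) + t *\<^sub>R (p - q) \<in> Q"
            by (simp add: recession_cone_iff)
          then show ?thesis by (simp add: algebra_simps)
        next
          case False
          then obtain n where n: "p + real n *\<^sub>R (t *\<^sub>R (p - q)) \<notin> S" by blast
          have "p + (real n * t) *\<^sub>R (p - q) \<in> affine hull S"
            using p q by (intro mem_affine_3_minus) (auto simp: hull_inc)
          then obtain u where u: "u \<in> {0..1}"
            and uQ: "p + u *\<^sub>R (p + real n *\<^sub>R (t *\<^sub>R (p - q)) - p) \<in> Q"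
            using boundary[OF p _ n] facets by auto
          \<comment> \<open>The second facet point is displaced from \<open>p\<close> by
            \<open>-s\<close> times the displacement of the first, so the weights
            \<open>s / (1 + s)\<close> and \<open>1 / (1 + s)\<close> make the displacements
            cancel.\<close>
          define s where "s = u * real n"
          have s: "s \<ge> 0" "p + s *\<^sub>R (t *\<^sub>R (p - q)) \<in> Q"
            using u uQ by (auto simp: s_def mult.assoc)
          have "(s / (1 + s)) *\<^sub>R (p + t *\<^sub>R (q - p)) + (1 / (1 + s)) *\<^sub>R (p + s *\<^sub>R (t *\<^sub>R (p - q))) \<in> Q"
            using s tQ Q(1) by (intro convexD) (auto simp: field_simps)
          also have "(s / (1 + s)) *\<^sub>R (p + t *\<^sub>R (q - p)) + (1 / (1 + s)) *\<^sub>R (p + s *\<^sub>R (t *\<^sub>R (p - q)))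
            = (s / (1 + s) + 1 / (1 + s)) *\<^sub>R p"
            by (simp add: algebra_simps)
          also have "s / (1 + s) + 1 / (1 + s) = 1"
            using s by (simp add: field_simps)
          finally show ?thesis by simp
        qed
      qed
    qed
  qed
qed

section \<open>Epigraphs and conjugates in real terms\<close>

lemma mem_epi [simp]: "(x, r) \<in> epi f \<longleftrightarrow> f x \<le> ereal r"
  by (simp add: epi_def)

lemma less_PInf_iff_le_ereal: "(z :: ereal) < \<infinity> \<longleftrightarrow> (\<exists>r. z \<le> ereal r)"
  by (cases z) auto

lemma mem_eff_dom_iff: "x \<in> eff_dom f \<longleftrightarrow> (\<exists>r. f x \<le> ereal r)"
  by (simp only: eff_dom_def mem_Collect_eq less_PInf_iff_le_ereal)

lemma eff_dom_subsetD:
  assumes "eff_dom f \<subseteq> eff_dom g" "f x \<le> ereal r"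
  obtains s where "g x \<le> ereal s"
  using assms by (meson mem_eff_dom_iff subsetD)

text \<open>Real upper bounds \<open>s\<close> in place of the value \<open>f x\<close> remove
  extended-real subtraction. If \<open>f x\<close> is minus infinity, \<open>s\<close> can be
  arbitrarily low and both sides fail.\<close>

lemma conjugate_le_iff:
  "conjugate f y \<le> ereal r \<longleftrightarrow> (\<forall>x s. f x \<le> ereal s \<longrightarrow> y \<bullet> x - s \<le> r)"
proof -
  have "ereal (y \<bullet> x) - f x \<le> ereal r \<longleftrightarrow> (\<forall>s. f x \<le> ereal s \<longrightarrow> y \<bullet> x - s \<le> r)" for x
  proof (cases "f x")
    case (real t)
    then show ?thesis by (auto intro: order_trans)
  next
    case MInf
    have "\<not> y \<bullet> x - (y \<bullet> x - r - 1) \<le> r" by simp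
    then have "\<exists>s. \<not> y \<bullet> x - s \<le> r" by blast
    with MInf show ?thesis by simp
  qed auto
  then show ?thesis by (auto simp: conjugate_def SUP_le_iff)
qed

lemma conjugate_ge: "ereal (y \<bullet> x) - f x \<le> conjugate f y"
  unfolding conjugate_def by (rule SUP_upper) simp

text \<open>Each point of \<open>epi f\<close> contributes one closed half-space, which makes the
  epigraph of the conjugate closed and convex for every \<open>f\<close>.\<close>

lemma epi_conjugate:
  "epi (conjugate f) = (\<Inter>p\<in>epi f. {z. (fst p, -1) \<bullet> z \<le> snd p})"
proof (rule set_eqI)
  fix z
  show "z \<in> epi (conjugate f) \<longleftrightarrow> z \<in> (\<Inter>p\<in>epi f. {z. (fst p, -1) \<bullet> z \<le> snd p})"
    unfolding INT_iff Ball_def split_paired_All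
    by (cases z) (simp add: conjugate_le_iff inner_commute algebra_simps)
qed

lemma convex_epi_conjugate: "convex (epi (conjugate f))"
  unfolding epi_conjugate by (intro convex_INT convex_halfspace_le)

lemma closed_epi_conjugate: "closed (epi (conjugate f))"
  unfolding epi_conjugate by (intro closed_INT ballI closed_halfspace_le)

section \<open>Polyhedral functions as maxima of affine pieces\<close>

text \<open>\<open>D\<close> collects the vertical half-spaces, which constrain the domain, and
  \<open>M\<close> the others, scaled to affine minorants. The upward ray over \<open>x0\<close>
  excludes half-spaces bounding \<open>r\<close> from above.\<close>

lemma polyhedral_convex_pieces:
  fixes f :: "'a::euclidean_space \<Rightarrow> ereal"
  assumes "polyhedral_convex f" and x0: "f x0 < \<infinity>"
  obtains D M :: "('a \<times> real) set" where "finite M"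
    "\<And>x r. f x \<le> ereal r \<longleftrightarrow> (\<forall>(a, b)\<in>D. a \<bullet> x \<le> b) \<and> (\<forall>(y, c)\<in>M. y \<bullet> x - c \<le> r)"
proof -
  obtain F where "finite F" and F: "epi f = \<Inter>F"
    and halfspaces: "\<forall>H\<in>F. \<exists>a b. a \<noteq> 0 \<and> H = {z. a \<bullet> z \<le> b}"
    using assms by (auto simp: polyhedral_convex_def polyhedron_def)
  have "\<exists>a b \<beta>. \<forall>x r. (x, r) \<in> H \<longleftrightarrow> a \<bullet> x - \<beta> * r \<le> b" if HF: "H \<in> F" for H
  proof -
    obtain z b where "H = {w. z \<bullet> w \<le> b}"
      using bspec[OF halfspaces HF] by (elim exE conjE)
    moreover obtain a t where "z = (a, t)" by fastforce
    ultimately have "(x, r) \<in> H \<longleftrightarrow> a \<bullet> x - - t * r \<le> b" for x r by simp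
    then show ?thesis by blast
  qed
  then obtain a b \<beta> where H: "\<And>H x r. H \<in> F \<Longrightarrow> (x, r) \<in> H \<longleftrightarrow> a H \<bullet> x - \<beta> H * r \<le> b H"
    by metis
  have le: "f x \<le> ereal r \<longleftrightarrow> (\<forall>H\<in>F. a H \<bullet> x - \<beta> H * r \<le> b H)" for x r
  proof -
    have "f x \<le> ereal r \<longleftrightarrow> (\<forall>H\<in>F. (x, r) \<in> H)"
      unfolding mem_epi[symmetric] F by simp
    then show ?thesis using H by simp
  qed
  have nonneg: "\<beta> H \<ge> 0" if "H \<in> F" for H
  proof (rule ccontr)
    assume neg: "\<not> \<beta> H \<ge> 0"
    obtain r0 where r0: "f x0 \<le> ereal r0" using x0 less_PInf_iff_le_ereal by blast
    \<comment> \<open>At the height given by the quotient, the left side of the half-space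
      inequality equals \<open>b H + 1\<close>.\<close>
    define r where "r = max r0 ((b H - a H \<bullet> x0 + 1) / - \<beta> H)"
    have "f x0 \<le> ereal r" using r0 by (rule order_trans) (simp add: r_def)
    then have "a H \<bullet> x0 - \<beta> H * r \<le> b H" using le that by blast
    moreover have "(b H - a H \<bullet> x0 + 1) / - \<beta> H \<le> r" by (simp add: r_def)
    then have "b H - a H \<bullet> x0 + 1 \<le> r * - \<beta> H"
      using neg by (subst (asm) pos_divide_le_eq) auto
    ultimately show False by (simp add: algebra_simps)
  qed
  define D where "D = (\<lambda>H. (a H, b H)) ` {H \<in> F. \<beta> H = 0}"
  define M where "M = (\<lambda>H. (a H /\<^sub>R \<beta> H, b H / \<beta> H)) ` {H \<in> F. \<beta> H > 0}"
  have "f x \<le> ereal r \<longleftrightarrow> (\<forall>(a, b)\<in>D. a \<bullet> x \<le> b) \<and> (\<forall>(y, c)\<in>M. y \<bullet> x - c \<le> r)" for x r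
  proof -
    have "f x \<le> ereal r \<longleftrightarrow> (\<forall>H\<in>F. \<beta> H = 0 \<longrightarrow> a H \<bullet> x - \<beta> H * r \<le> b H) \<and>
        (\<forall>H\<in>F. \<beta> H > 0 \<longrightarrow> a H \<bullet> x - \<beta> H * r \<le> b H)"
      unfolding le using nonneg by (metis order_le_less)
    also have "(\<forall>H\<in>F. \<beta> H = 0 \<longrightarrow> a H \<bullet> x - \<beta> H * r \<le> b H) \<longleftrightarrow> (\<forall>(a, b)\<in>D. a \<bullet> x \<le> b)"
      by (auto simp: D_def)
    also have "(\<forall>H\<in>F. \<beta> H > 0 \<longrightarrow> a H \<bullet> x - \<beta> H * r \<le> b H) \<longleftrightarrow> (\<forall>(y, c)\<in>M. y \<bullet> x - c \<le> r)"
      by (auto simp: M_def field_simps)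
    finally show ?thesis .
  qed
  moreover have "finite M" using \<open>finite F\<close> by (simp add: M_def)
  ultimately show ?thesis by (rule that[rotated])
qed

text \<open>The gradient of a piece \<open>(y, c)\<close> active at \<open>x0\<close> works: the
  piece is a minorant, so \<open>conjugate f y \<le> c\<close>, and Fenchel-Young at
  \<open>x0\<close> gives the reverse bound.\<close>

lemma polyhedral_convex_subgradient:
  fixes f :: "'a::euclidean_space \<Rightarrow> ereal"
  assumes "polyhedral_convex f" and R: "f x0 = ereal R"
  obtains y where "conjugate f y = ereal (y \<bullet> x0 - R)"
proof -
  obtain D M where "finite M" and pieces:
    "\<And>x r. f x \<le> ereal r \<longleftrightarrow> (\<forall>(a, b)\<in>D. a \<bullet> x \<le> b) \<and> (\<forall>(y, c)\<in>M. y \<bullet> x - c \<le> r)"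
  proof (rule polyhedral_convex_pieces[OF assms(1)])
    show "f x0 < \<infinity>" using R by simp
  qed blast
  \<comment> \<open>The extra element \<open>R - 1\<close> keeps \<open>T\<close> nonempty and shows that the maximum is attained in \<open>M\<close>.\<close>
  define T where "T = insert (R - 1) ((\<lambda>(y, c). y \<bullet> x0 - c) ` M)"
  have "finite T" using \<open>finite M\<close> by (simp add: T_def)
  have "y \<bullet> x0 - c \<le> Max T" if "(y, c) \<in> M" for y c
    using \<open>finite T\<close> by (rule Max_ge) (use that in \<open>force simp: T_def\<close>)
  moreover have "f x0 \<le> ereal R" using R by simp
  then have "\<forall>(a, b)\<in>D. a \<bullet> x0 \<le> b" unfolding pieces ..
  ultimately have "f x0 \<le> ereal (Max T)" by (auto simp: pieces)
  moreover have "Max T \<in> T" using \<open>finite T\<close> by (intro Max_in) (auto simp: T_def)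
  ultimately obtain y c where yc: "(y, c) \<in> M" "R \<le> y \<bullet> x0 - c"
    using R by (auto simp: T_def)
  have "conjugate f y \<le> ereal c"
    using yc(1) by (auto simp: conjugate_le_iff pieces algebra_simps)
  moreover have "ereal (y \<bullet> x0 - R) \<le> conjugate f y"
    using conjugate_ge[of y x0 f] R by simp
  moreover have "c \<le> y \<bullet> x0 - R" using yc(2) by simp
  ultimately have "conjugate f y = ereal (y \<bullet> x0 - R)"
    by (meson ereal_less_eq(3) order_antisym order_trans)
  then show ?thesis by (rule that)
qed

section \<open>Implications between the four conditions\<close>

text \<open>Turns optimality with value \<open>P - Q\<close> into a bound on \<open>q\<close> by
  \<open>p\<close>, phrased through real upper bounds. The finiteness condition in the definition
  supplies \<open>P\<close> and \<open>Q\<close>.\<close>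

lemma dc_optimal_solution_finite:
  assumes "dc_optimal_solution p q x0"
  obtains P Q where "p x0 = ereal P" "q x0 = ereal Q"
    "\<And>x r. p x \<le> ereal r \<Longrightarrow> q x \<le> ereal (r - (P - Q))"
proof -
  obtain P Q where PQ: "p x0 = ereal P" "q x0 = ereal Q"
    using assms by (cases "p x0"; cases "q x0") (auto simp: dc_optimal_solution_def eff_dom_def)
  have "q x \<le> ereal (r - (P - Q))" if "p x \<le> ereal r" for x r
  proof -
    have "x \<in> eff_dom p" using that by (auto simp: eff_dom_def intro: le_less_trans)
    then have "ereal (P - Q) \<le> p x - q x"
      using assms PQ by (auto simp: dc_optimal_solution_def)
    also have "\<dots> \<le> ereal r - q x" using that by (intro ereal_minus_mono) auto
    finally show ?thesis by (cases "q x") auto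
  qed
  with PQ show ?thesis by (rule that)
qed

text \<open>Applied to the conjugates, this is (b) => (d). A ray of \<open>epi p\<close>, shifted
  vertically by the optimal value, lies in \<open>epi q\<close>, and one ray in a closed convex set
  determines a recession direction.\<close>

lemma dc_optimal_solution_imp_recession:
  fixes p q :: "'a::real_normed_vector \<Rightarrow> ereal"
  assumes opt: "dc_optimal_solution p q x0" and "convex (epi q)" "closed (epi q)"
  shows "eff_dom p \<noteq> {} \<and> eff_dom p \<subseteq> eff_dom q \<and> recession_cone (epi p) \<subseteq> recession_cone (epi q)"
proof (intro conjI subsetI)
  obtain P Q where P: "p x0 = ereal P"
    and le: "\<And>x r. p x \<le> ereal r \<Longrightarrow> q x \<le> ereal (r - (P - Q))"
    using opt by (elim dc_optimal_solution_finite) blast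
  show "eff_dom p \<noteq> {}" using P by (force simp: eff_dom_def)
  show "x \<in> eff_dom q" if "x \<in> eff_dom p" for x
    using that le by (auto simp: mem_eff_dom_iff)
  show "w \<in> recession_cone (epi q)" if w: "w \<in> recession_cone (epi p)" for w
  proof (rule ray_imp_recession_cone)
    fix n
    have "(x0, P) + real n *\<^sub>R w \<in> epi p"
      using w P by (intro recession_cone_multiple) auto
    then show "(x0, P - (P - Q)) + real n *\<^sub>R w \<in> epi q"
      using le by (cases w) (force simp: algebra_simps)
  qed fact+
qed

text \<open>Toland duality. At a subgradient \<open>y\<close> of \<open>h\<close> at
  \<open>x0\<close> both conjugates are attained at \<open>x0\<close>, so their difference is again
  \<open>G - H\<close>: the two problems share their optimal value.\<close>

lemma toland_dual_optimal:
  fixes g h :: "'a::euclidean_space \<Rightarrow> ereal"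
  assumes opt: "dc_optimal_solution g h x0" and "polyhedral_convex h"
  shows "\<exists>y0. dc_optimal_solution (conjugate h) (conjugate g) y0"
proof -
  obtain G H where G: "g x0 = ereal G" and H: "h x0 = ereal H"
    and le: "\<And>x r. g x \<le> ereal r \<Longrightarrow> h x \<le> ereal (r - (G - H))"
    using opt by (rule dc_optimal_solution_finite) auto
  obtain y where y: "conjugate h y = ereal (y \<bullet> x0 - H)"
    using polyhedral_convex_subgradient[OF assms(2) H] .
  have dual: "conjugate g z \<le> ereal (r - (G - H))" if "conjugate h z \<le> ereal r" for z r
    using that le unfolding conjugate_le_iff by (force simp: algebra_simps)
  have "ereal (y \<bullet> x0 - G) \<le> conjugate g y"
    using conjugate_ge[of y x0 g] G by simp
  moreover have "conjugate g y \<le> ereal (y \<bullet> x0 - G)"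
    using dual[of y "y \<bullet> x0 - H"] y by simp
  ultimately have gy: "conjugate g y = ereal (y \<bullet> x0 - G)" by simp
  have "ereal (G - H) \<le> conjugate h z - conjugate g z" if z: "conjugate h z < \<infinity>" for z
  proof -
    have "conjugate h z \<noteq> -\<infinity>"
      using conjugate_ge[of z x0 h] H by auto
    with z obtain r where r: "conjugate h z = ereal r" by (cases "conjugate h z") auto
    then have "conjugate g z \<le> ereal (r - (G - H))" by (intro dual) simp
    with r show ?thesis by (cases "conjugate g z") auto
  qed
  with y gy have "dc_optimal_solution (conjugate h) (conjugate g) y"
    by (auto simp: dc_optimal_solution_def eff_dom_def)
  then show ?thesis ..
qed

text \<open>This is (d) => (c) once neither function is constantly infinite. Every bound arises by
  pairing points of \<open>epi g\<close> and \<open>epi (conjugate g)\<close> along a ray: a linear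
  function of \<open>n\<close> bounded above has nonpositive slope.\<close>

lemma recession_conjugate_imp:
  fixes g h :: "'a::euclidean_space \<Rightarrow> ereal"
  assumes "polyhedral_convex h" and h_proper: "h x1 < \<infinity>"
    and g_proper: "g x0 < \<infinity>"
    and dom_ne: "eff_dom (conjugate h) \<noteq> {}"
    and dom: "eff_dom (conjugate h) \<subseteq> eff_dom (conjugate g)"
    and rec: "recession_cone (epi (conjugate h)) \<subseteq> recession_cone (epi (conjugate g))"
  shows "eff_dom g \<subseteq> eff_dom h \<and> recession_cone (epi g) \<subseteq> recession_cone (epi h)"
proof -
  obtain D M where "finite M" and pieces:
    "\<And>x r. h x \<le> ereal r \<longleftrightarrow> (\<forall>(a, b)\<in>D. a \<bullet> x \<le> b) \<and> (\<forall>(y, c)\<in>M. y \<bullet> x - c \<le> r)"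
    using h_proper by (elim polyhedral_convex_pieces[OF assms(1)]) blast
  obtain y r where y: "conjugate h y \<le> ereal r"
    using dom_ne by (auto simp: mem_eff_dom_iff)
  \<comment> \<open>Since \<open>a \<bullet> x \<le> b\<close> wherever \<open>h\<close> is below
    infinity, adding \<open>(a, b)\<close> to an affine minorant of \<open>h\<close> yields another
    minorant.\<close>
  have D_rec: "(a, b) \<in> recession_cone (epi (conjugate h))" if "(a, b) \<in> D" for a b
    unfolding recession_cone_iff
  proof clarify
    fix z t assume "(z, t) \<in> epi (conjugate h)"
    then have "(z + a) \<bullet> x - s \<le> t + b" if "h x \<le> ereal s" for x s
      using that \<open>(a, b) \<in> D\<close> unfolding mem_epi conjugate_le_iff
      by (force simp: pieces inner_add_left)
    then show "(z, t) + (a, b) \<in> epi (conjugate h)"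
      by (simp add: conjugate_le_iff)
  qed
  have M_dom: "conjugate h y \<le> ereal c" if "(y, c) \<in> M" for y c
    using that by (auto simp: conjugate_le_iff pieces algebra_simps)
  have bounded: "t \<le> 0" if "\<And>n. real n * t \<le> C" for t C :: real
    using that reals_Archimedean3[of t] by (metis leD not_le_imp_less)
  \<comment> \<open>Here the ray runs in \<open>epi (conjugate g)\<close> in direction
    \<open>(a, b)\<close>, while the point over \<open>x\<close> stays fixed.\<close>
  have domD: "a \<bullet> x \<le> b" if ab: "(a, b) \<in> D" and x: "g x < \<infinity>" for a b x
  proof -
    obtain s where s: "g x \<le> ereal s" using x less_PInf_iff_le_ereal by blast
    obtain t where t: "conjugate g y \<le> ereal t"
      using eff_dom_subsetD[OF dom y] .
    have "real n * (a \<bullet> x - b) \<le> t + s - y \<bullet> x" for n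
    proof -
      have "(y, t) + real n *\<^sub>R (a, b) \<in> epi (conjugate g)"
        using rec D_rec[OF ab] t by (intro recession_cone_multiple) auto
      then have "(y + real n *\<^sub>R a) \<bullet> x - s \<le> t + real n * b"
        using s by (simp add: conjugate_le_iff)
      then show ?thesis by (simp add: algebra_simps)
    qed
    then show ?thesis using bounded[of "a \<bullet> x - b"] by force
  qed
  have "x \<in> eff_dom h" if "x \<in> eff_dom g" for x
  proof -
    \<comment> \<open>For empty \<open>M\<close> this \<open>Max\<close> is unspecified, but then
      any real bounds \<open>h x\<close>.\<close>
    have "y \<bullet> x - c \<le> Max ((\<lambda>(y, c). y \<bullet> x - c) ` M)" if "(y, c) \<in> M" for y c
      by (rule Max_ge) (use \<open>finite M\<close> that in force)+
    moreover have "a \<bullet> x \<le> b" if "(a, b) \<in> D" for a b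
      using domD[OF that] \<open>x \<in> eff_dom g\<close> by (simp add: eff_dom_def)
    ultimately have "h x \<le> ereal (Max ((\<lambda>(y, c). y \<bullet> x - c) ` M))"
      by (auto simp: pieces)
    then show ?thesis by (auto simp: eff_dom_def intro: le_less_trans)
  qed
  moreover have "w \<in> recession_cone (epi h)" if w: "w \<in> recession_cone (epi g)" for w
  proof -
    obtain u s where us: "w = (u, s)" by fastforce
    obtain G where G: "g x0 \<le> ereal G" using g_proper less_PInf_iff_le_ereal by blast
    \<comment> \<open>Now the ray runs in \<open>epi g\<close> and the point over \<open>z\<close>
      stays fixed.\<close>
    have rec_bound: "z \<bullet> u \<le> s" if z: "conjugate h z < \<infinity>" for z
    proof -
      obtain t where t: "conjugate g z \<le> ereal t"
        using z eff_dom_subsetD[OF dom] unfolding less_PInf_iff_le_ereal by metis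
      have "real n * (z \<bullet> u - s) \<le> t + G - z \<bullet> x0" for n
      proof -
        have "(x0, G) + real n *\<^sub>R w \<in> epi g"
          using w G by (intro recession_cone_multiple) auto
        then have "z \<bullet> (x0 + real n *\<^sub>R u) - (G + real n * s) \<le> t"
          using t unfolding conjugate_le_iff us by simp
        then show ?thesis by (simp add: algebra_simps)
      qed
      then show ?thesis using bounded[of "z \<bullet> u - s"] by force
    qed
    have M_le: "z \<bullet> u \<le> s" if "(z, c) \<in> M" for z c
      using M_dom[OF that] by (intro rec_bound) (auto intro: le_less_trans)
    \<comment> \<open>The domain of \<open>conjugate h\<close> contains \<open>y\<close> plus all
      multiples \<open>n\<close> of \<open>a\<close>, so \<open>rec_bound\<close> applies along this
      ray.\<close>
    have D_le: "a \<bullet> u \<le> 0" if "(a, b) \<in> D" for a b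
    proof (rule bounded)
      fix n
      have "(y, r) + real n *\<^sub>R (a, b) \<in> epi (conjugate h)"
        using D_rec[OF that] y by (intro recession_cone_multiple) auto
      then have "(y + real n *\<^sub>R a) \<bullet> u \<le> s"
        by (intro rec_bound) (auto intro: le_less_trans)
      then show "real n * (a \<bullet> u) \<le> s - y \<bullet> u" by (simp add: algebra_simps)
    qed
    have "h (x + u) \<le> ereal (t + s)" if "h x \<le> ereal t" for x t
      using that M_le D_le unfolding pieces by (force simp: inner_add_right)
    then show ?thesis by (auto simp: recession_cone_iff us)
  qed
  ultimately show ?thesis by blast
qed

text \<open>Finiteness of the generating set replaces compactness: a generator minimising the
  objective yields the solution.\<close>

lemma recession_imp_dc_optimal_solution:
  fixes g h :: "'a::euclidean_space \<Rightarrow> ereal"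
  assumes "polyhedron (epi g)" "convex (epi h)"
    and "\<And>x. g x \<noteq> -\<infinity>" "\<And>x. h x \<noteq> -\<infinity>"
    and dom_ne: "eff_dom g \<noteq> {}" and dom: "eff_dom g \<subseteq> eff_dom h"
    and rec: "recession_cone (epi g) \<subseteq> recession_cone (epi h)"
  shows "\<exists>x0. dc_optimal_solution g h x0"
proof -
  obtain V where "finite V" "V \<subseteq> epi g" and V:
    "\<And>Q. convex Q \<Longrightarrow> V \<subseteq> Q \<Longrightarrow> recession_cone (epi g) \<subseteq> recession_cone Q \<Longrightarrow> epi g \<subseteq> Q"
    using polyhedron_generators[OF assms(1)] by metis
  have h_real: "\<exists>t. h x = ereal t" if "g x \<le> ereal r" for x r
  proof -
    have "h x < \<infinity>"
      using eff_dom_subsetD[OF dom that] unfolding less_PInf_iff_le_ereal by metis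
    with assms(4)[of x] show ?thesis by (cases "h x") auto
  qed
  \<comment> \<open>The objective on points of \<open>epi g\<close>; \<open>real_of_ereal\<close>
    loses nothing there, by \<open>h_real\<close>.\<close>
  define \<phi> where "\<phi> = (\<lambda>(x, r). r - real_of_ereal (h x))"
  \<comment> \<open>Every vector is a recession direction of the empty set, so an empty
    \<open>V\<close> would make \<open>epi g\<close> empty.\<close>
  have "V \<noteq> {}"
  proof
    assume "V = {}"
    then have "epi g \<subseteq> {}" by (intro V) (auto simp: recession_cone_def)
    then show False using dom_ne by (auto simp: mem_eff_dom_iff epi_def)
  qed
  then obtain v where v: "v \<in> V" "\<And>z. z \<in> V \<Longrightarrow> \<phi> v \<le> \<phi> z"
    using \<open>finite V\<close> by (metis arg_min_if_finite(1) arg_min_least)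
  define m where "m = \<phi> v"
  define Q where "Q = (+) (0, m) ` epi h"
  have Q_iff: "(x, r) \<in> Q \<longleftrightarrow> h x \<le> ereal (r - m)" for x r
    by (auto simp: Q_def image_iff intro!: bexI[of _ "(x, r - m)"])
  have "epi g \<subseteq> Q"
  proof (rule V)
    show "convex Q" unfolding Q_def using assms(2) by (rule convex_translation)
    show "V \<subseteq> Q"
    proof clarify
      fix x r assume "(x, r) \<in> V"
      then have "m \<le> r - real_of_ereal (h x)" "g x \<le> ereal r"
        using v(2)[of "(x, r)"] \<open>V \<subseteq> epi g\<close> by (auto simp: m_def \<phi>_def)
      moreover from this obtain t where "h x = ereal t" using h_real by blast
      ultimately show "(x, r) \<in> Q" by (simp add: Q_iff)
    qed
    show "recession_cone (epi g) \<subseteq> recession_cone Q"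
    proof
      fix w assume "w \<in> recession_cone (epi g)"
      then have "w \<in> recession_cone (epi h)" using rec by blast
      then show "w \<in> recession_cone Q" by (simp add: recession_cone_iff Q_def add.assoc)
    qed
  qed
  then have lower: "h x \<le> ereal (r - m)" if "g x \<le> ereal r" for x r
    using that by (auto simp flip: Q_iff)
  obtain x0 r0 where x0: "v = (x0, r0)" by fastforce
  with v(1) \<open>V \<subseteq> epi g\<close> have r0: "g x0 \<le> ereal r0" by auto
  with assms(3)[of x0] obtain G where G: "g x0 = ereal G" by (cases "g x0") auto
  obtain H where H: "h x0 = ereal H" using h_real[OF r0] by blast
  \<comment> \<open>The generator may lie strictly above the graph of \<open>g\<close>, hence only
    an inequality; the lower bound \<open>m\<close> completes it.\<close>
  have "G - H \<le> m" using r0 G H by (simp add: m_def x0 \<phi>_def)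
  moreover have "ereal m \<le> g x - h x" if x: "x \<in> eff_dom g" for x
  proof -
    obtain r where r: "g x = ereal r"
      using x assms(3)[of x] by (cases "g x") (auto simp: eff_dom_def)
    then show ?thesis using lower[of x r] by (cases "h x") auto
  qed
  ultimately have "ereal (G - H) \<le> g x - h x" if "x \<in> eff_dom g" for x
    using that by (meson ereal_less_eq(3) order_trans)
  then have "dc_optimal_solution g h x0"
    using G H by (auto simp: dc_optimal_solution_def eff_dom_def)
  then show ?thesis ..
qed

text \<open>\<open>g_proper\<close> excludes the constantly infinite \<open>g\<close>, for which
  \<open>conjugate g\<close> is constantly minus infinity, so that \<open>d\<close> holds while
  \<open>a\<close>, \<open>b\<close> and \<open>c\<close> fail.\<close>

theorem corollary12:
  fixes g h :: "real ^ 'n \<Rightarrow> ereal"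
  assumes "\<And>x. g x \<noteq> -\<infinity>" and "\<And>x. h x \<noteq> -\<infinity>"
    and "polyhedral_convex g" and "polyhedral_convex h"
    and g_proper: "\<exists>x. g x \<noteq> \<infinity>"
  defines "a \<equiv> (\<exists>x0. dc_optimal_solution g h x0)"
    and "b \<equiv> (\<exists>y0. dc_optimal_solution (conjugate h) (conjugate g) y0)"
    and "c \<equiv> (eff_dom g \<noteq> {} \<and> eff_dom g \<subseteq> eff_dom h \<and>
              recession_cone (epi g) \<subseteq> recession_cone (epi h))"
    and "d \<equiv> (eff_dom (conjugate h) \<noteq> {} \<and> eff_dom (conjugate h) \<subseteq> eff_dom (conjugate g) \<and>
              recession_cone (epi (conjugate h)) \<subseteq> recession_cone (epi (conjugate g)))"
  shows "(a \<longleftrightarrow> b) \<and> (b \<longleftrightarrow> c) \<and> (c \<longleftrightarrow> d)"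
proof -
  obtain x0 where x0: "g x0 < \<infinity>" using g_proper by auto
  then have g_dom: "eff_dom g \<noteq> {}" by (auto simp: eff_dom_def)
  have "a \<Longrightarrow> b"
    unfolding a_def b_def using toland_dual_optimal assms(4) by blast
  moreover have "b \<Longrightarrow> d"
    unfolding b_def d_def
    using dc_optimal_solution_imp_recession convex_epi_conjugate closed_epi_conjugate by blast
  moreover have "d \<Longrightarrow> c"
  proof -
    assume d: d
    \<comment> \<open>Otherwise \<open>conjugate h\<close> is constantly \<open>-\<infinity>\<close> and \<open>epi (conjugate g)\<close> recedes downwards.\<close>
    have "\<exists>x1. h x1 < \<infinity>"
    proof (rule ccontr)
      assume "\<not> (\<exists>x1. h x1 < \<infinity>)"
      then have "epi (conjugate h) = UNIV"
        by (auto simp: conjugate_le_iff top.not_eq_extremum)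
      then have down: "(0, -1) \<in> recession_cone (epi (conjugate g))"
        using d unfolding d_def recession_cone_def by blast
      obtain y t where t: "conjugate g y \<le> ereal t"
        using d unfolding d_def by (metis ex_in_conv mem_eff_dom_iff subsetD)
      obtain s where s: "g x0 \<le> ereal s" using x0 less_PInf_iff_le_ereal by blast
      \<comment> \<open>After \<open>n\<close> steps down, \<open>(y, t)\<close> falls below the
        Fenchel-Young bound given by \<open>x0\<close>.\<close>
      obtain n where n: "t - (y \<bullet> x0 - s) < real n" using reals_Archimedean2 by blast
      have "(y, t) + real n *\<^sub>R (0, -1) \<in> epi (conjugate g)"
        using down t by (intro recession_cone_multiple) auto
      then have "y \<bullet> x0 - s \<le> t - real n"
        using s by (simp add: conjugate_le_iff)
      with n show False by simp
    qed
    then obtain x1 where "h x1 < \<infinity>" ..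
    with d show c
      unfolding c_def d_def
      using recession_conjugate_imp[of h x1 g x0] assms(4) x0 g_dom by simp
  qed
  moreover have "c \<Longrightarrow> a"
    unfolding a_def c_def using assms(1-4)
    by (intro recession_imp_dc_optimal_solution) (simp_all add: polyhedral_convex_def)
  ultimately show ?thesis by blast
qed

end
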